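(* Let $p$ be a prime and let $n$ be a positive integer. Define $f:\mathbb{N}\to\mathbb{N}$ (with $0\in\mathbb{N}$) by $f(0)=1$ and $f(r)=\prod_{s=1}^{r}(p^s-1)$ for all $r\geq 1$. Then the number $F(\mathbb{Z}_p^n)$ of rooted chains of subgroups of the elementary abelian $p$-group $\mathbb{Z}_p^n$ is $$F(\mathbb{Z}_p^n)=2+2f(n)\sum_{k=1}^{n-1}\ \sum_{1\leq i_1<i_2<\cdots<i_k\leq n-1}\frac{1}{f(n-i_k)\,f(i_k-i_{k-1})\cdots f(i_2-i_1)\,f(i_1)}\,,$$ where the inner sum is over all strictly increasing $k$-tuples of integers $(i_1,\dots,i_k)$ with entries in $\{1,\dots,n-1\}$, the fractions are rational numbers, and an empty sum (the case $n=1$) equals $0$.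
   Context: $\mathbb{Z}_p^n$ denotes the elementary abelian $p$-group of rank $n$, i.e. the direct product of $n$ copies of the cyclic group $\mathbb{Z}_p$ of order $p$. For a group $G$, a chain of subgroups of $G$ is a set of subgroups of $G$ that is totally ordered by set inclusion. A chain of subgroups of $G$ is called rooted (more exactly, $G$-rooted) if it contains $G$ itself as a member. For a finite group $G$, $F(G)$ denotes the number of $G$-rooted chains of subgroups of $G$. In the formula, the denominator for given $i_1<\cdots<i_k$ is the product $f(n-i_k)\cdot\prod_{j=2}^{k}f(i_j-i_{j-1})\cdot f(i_1)$; for $k=1$ it is $f(n-i_1)f(i_1)$. *)

theory Defs
  imports "HOL-Algebra.Product_Groups" "HOL-Computational_Algebra.Primes"
begin

definition elem_abelian_group :: "nat \<Rightarrow> nat \<Rightarrow> (nat \<Rightarrow> int) monoid" where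
  "elem_abelian_group p n = product_group {1..n} (\<lambda>_. integer_mod_group p)"

definition rooted_chains :: "('a, 'b) monoid_scheme \<Rightarrow> 'a set set set" where
  "rooted_chains G = {\<C>. subset.chain {H. subgroup H G} \<C> \<and> carrier G \<in> \<C>}"

text \<open>Only meaningful for finite \<open>G\<close>: for an infinite set of chains \<open>card\<close> is \<open>0\<close>.\<close>

definition num_rooted_chains :: "('a, 'b) monoid_scheme \<Rightarrow> nat" where
  "num_rooted_chains G = card (rooted_chains G)"

text \<open>The subtraction is on natural numbers, but it is never truncated when \<open>p \<ge> 1\<close>.\<close>

definition pow_fact :: "nat \<Rightarrow> nat \<Rightarrow> nat" where
  "pow_fact p r = (\<Prod>s = 1..r. (p ^ s - 1))"

text \<open>A tuple \<open>(i\<^sub>1, \<dots>, i\<^sub>k)\<close> is encoded as a function on \<open>{1..k}\<close>, extensional (via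
  \<open>\<rightarrow>\<^sub>E\<close>) so that each tuple is represented by exactly one function.\<close>

definition increasing_tuples :: "nat \<Rightarrow> nat \<Rightarrow> (nat \<Rightarrow> nat) set" where
  "increasing_tuples k m = {i \<in> {1..k} \<rightarrow>\<^sub>E {1..m}. strict_mono_on {1..k} i}"

end

theory Submission
  imports Defs
begin

text \<open>Removing \<open>H\<close> from an \<open>H\<close>-rooted chain leaves either nothing or a chain rooted at its
  maximum, so \<open>F(H) = 1 + \<Sum>\<^bsub>K < H\<^esub> F(K)\<close>. In an elementary abelian group the number of
  subgroups of order \<open>p\<^sup>i\<close> of a group of order \<open>p\<^sup>m\<close> is \<open>f(m) / (f(i) f(m - i))\<close>, because
  independent \<open>i\<close>-tuples are counted by \<open>\<Prod>\<^bsub>j < i\<^esub> (p\<^sup>m - p\<^sup>j)\<close> and each spans a unique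
  subgroup of order \<open>p\<^sup>i\<close>. Splitting off the last entry of an increasing tuple shows that
  \<open>S(n) = 1 + f(n) \<Sum> \<dots>\<close> satisfies \<open>S(n) = 1 + \<Sum>\<^bsub>0 < i < n\<^esub> f(n) / (f(i) f(n - i)) S(i)\<close>,
  and \<open>F = 2 S\<close> for nontrivial groups follows by induction, the trivial subgroup accounting for
  the additional summand \<open>1\<close>.\<close>

section \<open>Counting chains below a given root\<close>

text \<open>The ambient family \<open>\<S>\<close> stays fixed while the root \<open>A\<close>
  varies, so a recursion can descend to smaller roots without changing the group whose subgroups are
  considered.\<close>

definition rooted_subchains :: "'a set set \<Rightarrow> 'a set \<Rightarrow> 'a set set set" where
  "rooted_subchains \<S> A = {\<C>. subset.chain \<S> \<C> \<and> A \<in> \<C> \<and> (\<forall>B\<in>\<C>. B \<subseteq> A)}"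

lemma finite_rooted_subchains: "finite \<S> \<Longrightarrow> finite (rooted_subchains \<S> A)"
  by (rule finite_subset[of _ "Pow \<S>"]) (auto simp: rooted_subchains_def subset_chain_def)

lemma rooted_subchains_rec:
  assumes "finite \<S>" "A \<in> \<S>"
  shows "rooted_subchains \<S> A =
    insert {A} (insert A ` (\<Union>B\<in>{B\<in>\<S>. B \<subset> A}. rooted_subchains \<S> B))"
proof (intro equalityI subsetI)
  fix \<C> assume C: "\<C> \<in> rooted_subchains \<S> A"
  show "\<C> \<in> insert {A} (insert A ` (\<Union>B\<in>{B\<in>\<S>. B \<subset> A}. rooted_subchains \<S> B))"
  proof (cases "\<C> = {A}")
    case False
    let ?D = "\<C> - {A}"
    have chain: "subset.chain \<S> ?D"
      using C by (auto simp: rooted_subchains_def subset_chain_def)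
    have "finite ?D"
      using C assms(1) by (auto simp: rooted_subchains_def subset_chain_def intro: finite_subset)
    moreover have "?D \<noteq> {}"
      using C False by (auto simp: rooted_subchains_def)
    \<comment> \<open>A finite nonempty chain contains its own union, which is therefore its largest
      member and becomes the new root.\<close>
    ultimately have max: "\<Union>?D \<in> ?D"
      using chain by (intro Union_in_chain)
    moreover have "?D \<in> rooted_subchains \<S> (\<Union>?D)"
      using chain max by (auto simp: rooted_subchains_def)
    moreover have "\<Union>?D \<in> {B\<in>\<S>. B \<subset> A}"
    proof -
      have "\<Union>?D \<in> \<S>" using chain max by (auto simp: subset_chain_def)
      moreover have "\<Union>?D \<subseteq> A" "\<Union>?D \<noteq> A"
        using C max by (auto simp: rooted_subchains_def)
      ultimately show ?thesis by blast
    qed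
    moreover have "\<C> = insert A ?D"
      using C by (auto simp: rooted_subchains_def)
    ultimately show ?thesis by blast
  qed simp
next
  fix \<C> assume "\<C> \<in> insert {A} (insert A ` (\<Union>B\<in>{B\<in>\<S>. B \<subset> A}. rooted_subchains \<S> B))"
  then show "\<C> \<in> rooted_subchains \<S> A"
  proof (elim insertE imageE UN_E)
    assume "\<C> = {A}"
    then show ?thesis using assms(2) by (auto simp: rooted_subchains_def subset_chain_def)
  next
    fix \<D> B assume "\<C> = insert A \<D>" "B \<in> {B\<in>\<S>. B \<subset> A}" "\<D> \<in> rooted_subchains \<S> B"
    then have "subset.chain \<S> \<D>" and "\<forall>C\<in>\<D>. C \<subset> A" and "\<C> = insert A \<D>"
      by (auto simp: rooted_subchains_def)
    then show ?thesis using assms(2)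
      by (simp add: rooted_subchains_def subset_chain_insert less_imp_le)
  qed
qed

lemma card_rooted_subchains_rec:
  assumes "finite \<S>" "A \<in> \<S>"
  shows "card (rooted_subchains \<S> A) =
    1 + (\<Sum>B\<in>{B\<in>\<S>. B \<subset> A}. card (rooted_subchains \<S> B))"
proof -
  let ?U = "\<Union>B\<in>{B\<in>\<S>. B \<subset> A}. rooted_subchains \<S> B"
  have fin: "finite ?U" using assms(1) by (auto intro: finite_rooted_subchains)
  have notin: "A \<notin> \<C>" if "\<C> \<in> ?U" for \<C>
    using that by (auto simp: rooted_subchains_def)
  then have "inj_on (insert A) ?U"
    by (intro inj_onI) (metis insert_ident)
  \<comment> \<open>Only the empty chain could yield \<open>{A}\<close>, and the empty chain has no
    root.\<close>
  moreover have "{A} \<notin> insert A ` ?U"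
  proof
    assume "{A} \<in> insert A ` ?U"
    then obtain \<C> where "\<C> \<in> ?U" "{A} = insert A \<C>" by auto
    with notin have "\<C> = {}" by blast
    with \<open>\<C> \<in> ?U\<close> show False by (auto simp: rooted_subchains_def)
  qed
  ultimately have "card (rooted_subchains \<S> A) = 1 + card ?U"
    using fin by (simp add: rooted_subchains_rec[OF assms] card_image)
  also have "card ?U = (\<Sum>B\<in>{B\<in>\<S>. B \<subset> A}. card (rooted_subchains \<S> B))"
  \<comment> \<open>Disjointness: a chain has only one largest member, so it determines its
    root.\<close>
  proof (rule card_UN_disjoint)
    show "\<forall>B\<in>{B\<in>\<S>. B \<subset> A}. finite (rooted_subchains \<S> B)"
      using assms(1) by (simp add: finite_rooted_subchains)
  qed (use assms(1) in \<open>auto simp: rooted_subchains_def\<close>)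
  finally show ?thesis .
qed

section \<open>Adjoining an element to a subgroup\<close>

text \<open>Such a group is a finite vector space over the field with \<open>p\<close> elements in
  multiplicative notation; subgroups are its subspaces, and the linear algebra is done with powers
  instead of scalars.\<close>

locale elementary_abelian_group = comm_group G for G (structure) +
  fixes p :: nat
  assumes prime: "prime p"
    and finite_carrier: "finite (carrier G)"
    and pow_exponent: "x \<in> carrier G \<Longrightarrow> x [^] p = \<one>"
begin

text \<open>Restricting exponents to \<open>{..<p}\<close> makes the parametrization injective when
  \<open>x\<close> lies outside the subgroup \<open>H\<close>, so the order can be read off;
  arbitrary exponents are reduced modulo \<open>p\<close> in \<open>adjoinI\<close>.\<close>

definition adjoin :: "'a \<Rightarrow> 'a set \<Rightarrow> 'a set" where
  "adjoin x H = (\<lambda>(h, i). h \<otimes> x [^] i) ` (H \<times> {..<p})"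

lemma p_pos: "p > 0"
  using prime by (simp add: prime_gt_0_nat)

lemma pow_mod_exponent:
  assumes "x \<in> carrier G"
  shows "x [^] (i mod p) = x [^] (i::nat)"
proof -
  have "x [^] i = x [^] (p * (i div p) + i mod p)" by simp
  also have "\<dots> = (x [^] p) [^] (i div p) \<otimes> x [^] (i mod p)"
    using assms by (simp only: nat_pow_mult[symmetric] nat_pow_pow)
  finally show ?thesis using assms by (simp add: pow_exponent)
qed

lemma adjoinI:
  assumes "x \<in> carrier G" "h \<in> H"
  shows "h \<otimes> x [^] (i::nat) \<in> adjoin x H"
proof -
  have "(h, i mod p) \<in> H \<times> {..<p}" using assms p_pos by simp
  then have "(\<lambda>(h, i). h \<otimes> x [^] i) (h, i mod p) \<in> adjoin x H"
    unfolding adjoin_def by (rule imageI)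
  then show ?thesis using assms by (simp add: pow_mod_exponent)
qed

lemma adjoinE:
  assumes "y \<in> adjoin x H"
  obtains h and i :: nat where "h \<in> H" "y = h \<otimes> x [^] i"
  using assms by (auto simp: adjoin_def)

lemma subgroup_adjoin:
  assumes H: "subgroup H G" and x: "x \<in> carrier G"
  shows "subgroup (adjoin x H) G"
proof -
  interpret H: subgroup H G by (rule H)
  have sub: "adjoin x H \<subseteq> carrier G"
    using x by (auto elim!: adjoinE)
  show ?thesis
  proof (rule subgroupI[OF sub])
    show "adjoin x H \<noteq> {}" using adjoinI[OF x H.one_closed] by blast
  next
    fix a assume "a \<in> adjoin x H"
    then obtain h and i :: nat where a: "h \<in> H" "a = h \<otimes> x [^] i" by (rule adjoinE)
    \<comment> \<open>The inverse of \<open>x [^] i\<close> is written with a natural exponent so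
      that it has the form required by \<open>adjoinI\<close>.\<close>
    have "x [^] i \<otimes> x [^] (i * (p - 1)) = (x [^] p) [^] i"
      using x p_pos by (simp add: nat_pow_mult nat_pow_pow diff_mult_distrib2 mult.commute[of p i])
    then have "x [^] i \<otimes> x [^] (i * (p - 1)) = \<one>" using x by (simp add: pow_exponent)
    then have "inv (x [^] i) = x [^] (i * (p - 1))"
      using x by (metis inv_equality m_comm nat_pow_closed)
    then have "inv a = inv h \<otimes> x [^] (i * (p - 1))"
      using a x by (simp add: inv_mult)
    then show "inv a \<in> adjoin x H" using a x by (simp add: adjoinI)
  next
    fix a b assume "a \<in> adjoin x H" "b \<in> adjoin x H"
    then obtain h k and i j :: nat
      where "h \<in> H" "a = h \<otimes> x [^] i" "k \<in> H" "b = k \<otimes> x [^] j"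
      by (auto elim!: adjoinE)
    moreover from this have "a \<otimes> b = (h \<otimes> k) \<otimes> x [^] (i + j)"
      using x by (simp add: nat_pow_mult[symmetric] m_ac)
    ultimately show "a \<otimes> b \<in> adjoin x H" using x by (simp add: adjoinI)
  qed
qed

text \<open>The exponent \<open>d\<close> is invertible modulo \<open>p\<close>, so \<open>x\<close>
  is itself a power of \<open>x [^] d\<close>.\<close>

lemma pow_in_subgroup_imp:
  assumes H: "subgroup H G" and x: "x \<in> carrier G"
    and "x [^] (d::nat) \<in> H" "0 < d" "d < p"
  shows "x \<in> H"
proof -
  have "coprime d p"
    using assms(4,5) prime by (metis coprime_commute nat_dvd_not_less prime_imp_coprime)
  then obtain e y where "d * e = p * y + 1"
    using bezout_nat[of d p] assms(4) by auto
  then have "(d * e) mod p = 1"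
    using prime_gt_1_nat[OF prime] by (metis mod_less mod_mult_self4)
  then have "x [^] (d * e) = x" using pow_mod_exponent[OF x, of "d * e"] x by simp
  moreover have "(x [^] d) [^] e \<in> H"
    using assms(3) H by (induction e) (auto intro: subgroup.one_closed subgroup.m_closed)
  ultimately show ?thesis using x by (simp add: nat_pow_pow)
qed

text \<open>If two products agreed with exponents \<open>i < j < p\<close>, then
  \<open>x [^] (j - i)\<close> would lie in \<open>H\<close>, and hence so would \<open>x\<close>.
  So all products of an element of \<open>H\<close> with a power of \<open>x\<close> below
  \<open>p\<close> are distinct.\<close>

lemma card_adjoin:
  assumes H: "subgroup H G" and x: "x \<in> carrier G" "x \<notin> H"
  shows "card (adjoin x H) = p * card H"
proof -
  interpret H: subgroup H G by (rule H)
  have *: "i = j" if eq: "h \<otimes> x [^] i = k \<otimes> x [^] j"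
    and "h \<in> H" "k \<in> H" "i \<le> j" "j < p" for h k and i j :: nat
  proof (rule ccontr)
    assume "i \<noteq> j"
    have "h \<otimes> x [^] i = (k \<otimes> x [^] (j - i)) \<otimes> x [^] i"
      using that x by (simp add: m_assoc nat_pow_mult)
    then have "h = k \<otimes> x [^] (j - i)" using that x by simp
    then have "x [^] (j - i) = inv k \<otimes> h"
      using that x by (simp add: m_assoc[symmetric])
    then have "x [^] (j - i) \<in> H" using that by simp
    moreover have "0 < j - i" "j - i < p" using that \<open>i \<noteq> j\<close> by auto
    ultimately show False using pow_in_subgroup_imp[OF H x(1)] x(2) by blast
  qed
  have "inj_on (\<lambda>(h, i). h \<otimes> x [^] i) (H \<times> {..<p})"
  proof (rule inj_onI)
    fix u v
    assume uv: "u \<in> H \<times> {..<p}" "v \<in> H \<times> {..<p}"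
      "(\<lambda>(h, i). h \<otimes> x [^] i) u = (\<lambda>(h, i). h \<otimes> x [^] i) v"
    obtain h i k j where [simp]: "u = (h, i)" "v = (k, j)" by fastforce
    from uv have a: "h \<in> H" "k \<in> H" "i < p" "j < p" "h \<otimes> x [^] i = k \<otimes> x [^] j" by auto
    have "i = j"
      using *[OF a(5) a(1,2)] *[OF a(5)[symmetric] a(2,1)] a(3,4) by linarith
    with a x show "u = v" by simp
  qed
  then show ?thesis
    by (simp add: adjoin_def card_image card_cartesian_product)
qed

section \<open>Spans, independent lists and subgroups of given order\<close>

fun span :: "'a list \<Rightarrow> 'a set" where
  "span [] = {\<one>}"
| "span (x # xs) = adjoin x (span xs)"

text \<open>For lists in the carrier this is linear independence over the field with
  \<open>p\<close> elements, in a form that allows counting by extension at the head.\<close>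

fun independent :: "'a list \<Rightarrow> bool" where
  "independent [] \<longleftrightarrow> True"
| "independent (x # xs) \<longleftrightarrow> independent xs \<and> x \<notin> span xs"

lemma subgroup_span: "set xs \<subseteq> carrier G \<Longrightarrow> subgroup (span xs) G"
  by (induction xs) (auto intro: triv_subgroup subgroup_adjoin)

lemma span_subset:
  assumes H: "subgroup H G"
  shows "set xs \<subseteq> H \<Longrightarrow> span xs \<subseteq> H"
proof (induction xs)
  case Nil
  then show ?case using H by (simp add: subgroup.one_closed)
next
  case (Cons x xs)
  then have "x [^] (i::nat) \<in> H" for i
    using H by (induction i) (auto intro: subgroup.one_closed subgroup.m_closed)
  with Cons show ?case
    using H by (auto elim!: adjoinE intro!: subgroup.m_closed)
qed

lemma set_subset_span: "set xs \<subseteq> carrier G \<Longrightarrow> set xs \<subseteq> span xs"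
proof (induction xs)
  case (Cons x xs)
  then have sg: "subgroup (span xs) G" and x: "x \<in> carrier G" by (auto intro: subgroup_span)
  have "x \<in> adjoin x (span xs)"
    using adjoinI[OF x subgroup.one_closed[OF sg], of 1] x by simp
  moreover have "y \<in> adjoin x (span xs)" if "y \<in> span xs" for y
    using adjoinI[OF x that, of 0] x subgroup.mem_carrier[OF sg that] by simp
  ultimately show ?case using Cons by auto
qed simp

lemma card_span:
  "set xs \<subseteq> carrier G \<Longrightarrow> independent xs \<Longrightarrow> card (span xs) = p ^ length xs"
  by (induction xs) (auto simp: card_adjoin subgroup_span)

definition independent_lists :: "'a set \<Rightarrow> nat \<Rightarrow> 'a list set" where
  "independent_lists H k = {xs. length xs = k \<and> set xs \<subseteq> H \<and> independent xs}"

lemma finite_subgroup: "subgroup H G \<Longrightarrow> finite H"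
  using finite_carrier by (meson finite_subset subgroup.subset)

lemma finite_independent_lists: "subgroup H G \<Longrightarrow> finite (independent_lists H k)"
  by (rule finite_subset[OF _ finite_lists_length_eq[of H k]])
    (auto simp: independent_lists_def finite_subgroup)

text \<open>An independent list of length \<open>k\<close> spans \<open>p ^ k\<close> elements of
  \<open>H\<close>, and exactly these are excluded as the next entry. For \<open>k > m\<close> the
  factor at \<open>j = m\<close> makes the product zero, and there are no such lists.\<close>

lemma card_independent_lists:
  assumes H: "subgroup H G" "card H = p ^ m"
  shows "card (independent_lists H k) = (\<Prod>j<k. p ^ m - p ^ j)"
proof (induction k)
  case 0
  have "independent_lists H 0 = {[]}" by (auto simp: independent_lists_def)
  then show ?case by simp
next
  case (Suc k)
  let ?L = "independent_lists H k"
  have "independent_lists H (Suc k) =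
    (\<lambda>(xs, x). x # xs) ` (SIGMA xs:?L. H - span xs)"
    by (force simp: independent_lists_def image_iff length_Suc_conv)
  then have "card (independent_lists H (Suc k)) = card (SIGMA xs:?L. H - span xs)"
    by (simp add: card_image inj_on_def split_beta)
  also have "\<dots> = (\<Sum>xs\<in>?L. card (H - span xs))"
    using H by (simp add: finite_independent_lists finite_subgroup)
  also have "\<dots> = (\<Sum>xs\<in>?L. p ^ m - p ^ k)"
  proof (rule sum.cong)
    fix xs assume "xs \<in> ?L"
    then have xs: "length xs = k" "set xs \<subseteq> H" "independent xs"
      by (auto simp: independent_lists_def)
    then have "span xs \<subseteq> H" "card (span xs) = p ^ k"
      using H subgroup.subset[OF H(1)] by (auto simp: span_subset card_span)
    then show "card (H - span xs) = p ^ m - p ^ k"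
      using H by (simp add: card_Diff_subset finite_subgroup finite_subset)
  qed simp
  finally show ?case by (simp add: Suc)
qed

text \<open>Double counting: the independent lists of length \<open>i\<close> in \<open>H\<close>
  are sorted by the subgroup of order \<open>p ^ i\<close> that they span.\<close>

lemma card_subgroups_mult:
  assumes H: "subgroup H G" "card H = p ^ m"
  shows "card {K. subgroup K G \<and> K \<subseteq> H \<and> card K = p ^ i} * (\<Prod>j<i. p ^ i - p ^ j) =
    (\<Prod>j<i. p ^ m - p ^ j)"
proof -
  let ?\<K> = "{K. subgroup K G \<and> K \<subseteq> H \<and> card K = p ^ i}"
  have "independent_lists H i = (\<Union>K\<in>?\<K>. independent_lists K i)"
  proof (intro equalityI subsetI)
    fix xs assume "xs \<in> independent_lists H i"
    then have xs: "length xs = i" "set xs \<subseteq> H" "independent xs"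
      by (auto simp: independent_lists_def)
    then have c: "set xs \<subseteq> carrier G" using subgroup.subset[OF H(1)] by blast
    have "span xs \<in> ?\<K>"
      using xs H c by (simp add: subgroup_span span_subset card_span)
    moreover have "xs \<in> independent_lists (span xs) i"
      using xs c set_subset_span by (simp add: independent_lists_def)
    ultimately show "xs \<in> (\<Union>K\<in>?\<K>. independent_lists K i)" by blast
  qed (auto simp: independent_lists_def)
  \<comment> \<open>The span lies in \<open>K\<close> and has the same finite order
    \<open>p ^ i\<close>, so the list determines \<open>K\<close>.\<close>
  moreover have "K = span xs" if "K \<in> ?\<K>" "xs \<in> independent_lists K i" for K xs
  proof -
    have "span xs \<subseteq> K" "card (span xs) = card K" "finite K"
      using that subgroup.subset[of K G]
      by (auto simp: independent_lists_def span_subset card_span finite_subgroup)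
    then show ?thesis by (metis card_subset_eq)
  qed
  then have "K = K'" if "K \<in> ?\<K>" "K' \<in> ?\<K>" "xs \<in> independent_lists K i"
      "xs \<in> independent_lists K' i" for K K' xs
    using that by metis
  then have "\<forall>K\<in>?\<K>. \<forall>K'\<in>?\<K>. K \<noteq> K' \<longrightarrow> independent_lists K i \<inter> independent_lists K' i = {}"
    by blast
  moreover have "finite ?\<K>"
    using finite_subgroup[OF H(1)] by (auto intro: finite_subset[of _ "Pow H"])
  ultimately have "card (independent_lists H i) = (\<Sum>K\<in>?\<K>. card (independent_lists K i))"
    by (simp add: card_UN_disjoint finite_independent_lists)
  then show ?thesis using H by (simp add: card_independent_lists)
qed

end

section \<open>Gaussian binomial coefficients and sums over proper subgroups\<close>

lemma pow_fact_pos: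
  assumes "p \<ge> 2"
  shows "pow_fact p r > 0"
proof -
  have "1 < p ^ s" if "s \<in> {1..r}" for s
    using assms that by (intro one_less_power) auto
  then show ?thesis by (simp add: pow_fact_def prod_pos)
qed

lemma pow_fact_0 [simp]: "pow_fact p 0 = 1"
  by (simp add: pow_fact_def)

lemma pow_fact_Suc [simp]: "pow_fact p (Suc r) = pow_fact p r * (p ^ Suc r - 1)"
  by (simp add: pow_fact_def)

text \<open>Pulling \<open>p ^ j\<close> out of each factor leaves \<open>p ^ (m - j) - 1\<close>;
  these are the top \<open>i\<close> factors of \<open>pow_fact p m\<close>.\<close>

lemma prod_pow_diff:
  assumes "i \<le> m"
  shows "(\<Prod>j<i. p ^ m - p ^ j) * pow_fact p (m - i) = (\<Prod>j<i. p ^ j) * pow_fact p m"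
  using assms
proof (induction i)
  case (Suc i)
  then have m: "m - i = Suc (m - Suc i)" and le: "i \<le> m" by simp_all
  have "p ^ m - p ^ i = p ^ i * (p ^ (m - i) - 1)"
    using le by (simp add: diff_mult_distrib2 flip: power_add)
  then have "(\<Prod>j<Suc i. p ^ m - p ^ j) * pow_fact p (m - Suc i) =
      p ^ i * ((\<Prod>j<i. p ^ m - p ^ j) * pow_fact p (m - i))"
    unfolding m by simp
  with Suc.IH[OF le] show ?case by (simp add: mult_ac)
qed simp

context elementary_abelian_group
begin

lemma p_ge_2: "p \<ge> 2"
  using prime by (rule prime_ge_2_nat)

text \<open>The count is a Gaussian binomial coefficient, stated without division. The powers of
  \<open>p\<close> extracted by \<open>prod_pow_diff\<close> occur on both sides and cancel.\<close>

lemma card_subgroups: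
  assumes H: "subgroup H G" "card H = p ^ m" and "i \<le> m"
  shows "card {K. subgroup K G \<and> K \<subseteq> H \<and> card K = p ^ i} * pow_fact p i * pow_fact p (m - i) =
    pow_fact p m" (is "?N * _ * _ = _")
proof -
  let ?c = "\<Prod>j<i. p ^ j"
  have "?c * (?N * pow_fact p i * pow_fact p (m - i)) = ?N * (?c * pow_fact p i) * pow_fact p (m - i)"
    by simp
  also have "?c * pow_fact p i = (\<Prod>j<i. p ^ i - p ^ j)"
    using prod_pow_diff[of i i p] by simp
  also have "?N * (\<Prod>j<i. p ^ i - p ^ j) * pow_fact p (m - i) = ?c * pow_fact p m"
    using prod_pow_diff[OF assms(3), of p] by (simp add: card_subgroups_mult[OF H])
  finally have "?c * (?N * pow_fact p i * pow_fact p (m - i)) = ?c * pow_fact p m" .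
  moreover have "?c \<noteq> 0" using p_pos by simp
  ultimately show ?thesis by (simp only: mult_cancel1 simp_thms)
qed

lemma card_subgroup_dvd:
  assumes "subgroup H G" "subgroup K G" "K \<subseteq> H"
  shows "card K dvd card H"
proof -
  interpret H: group "G\<lparr>carrier := H\<rparr>" using assms(1) by (rule subgroup_imp_group)
  have "subgroup K (G\<lparr>carrier := H\<rparr>)"
    using assms by (simp add: subgroup_incl)
  from H.lagrange[OF this] show ?thesis
    by (intro dvdI[of _ _ "card (rcosets\<^bsub>G\<lparr>carrier := H\<rparr>\<^esub> K)"]) (simp add: order_def mult.commute)
qed

text \<open>By Lagrange each proper subgroup has order \<open>p ^ i\<close> with
  \<open>i < m\<close>; grouping by order makes the Gaussian binomial coefficients appear as
  weights. The condition on \<open>F\<close> concerns proper subgroups only, so an induction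
  hypothesis can supply it.\<close>

lemma sum_proper_subgroups:
  fixes g :: "nat \<Rightarrow> 'c::field_char_0"
  assumes H: "subgroup H G" "card H = p ^ m"
    and g: "\<And>K i. subgroup K G \<Longrightarrow> K \<subset> H \<Longrightarrow> card K = p ^ i \<Longrightarrow> i < m \<Longrightarrow> F K = g i"
  shows "(\<Sum>K\<in>{K. subgroup K G \<and> K \<subset> H}. F K) =
    (\<Sum>i<m. of_nat (pow_fact p m) / (of_nat (pow_fact p i) * of_nat (pow_fact p (m - i))) * g i)"
proof -
  let ?S = "\<lambda>i. {K. subgroup K G \<and> K \<subseteq> H \<and> card K = p ^ i}"
  have finH: "finite H" using H(1) by (rule finite_subgroup)
  have fin: "finite (?S i)" for i using finH by (auto intro: finite_subset[of _ "Pow H"])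
  have proper: "K \<subset> H" if "K \<in> ?S i" "i < m" for K i
    using that H p_ge_2 by auto
  have "{K. subgroup K G \<and> K \<subset> H} = (\<Union>i\<in>{..<m}. ?S i)"
  proof (intro equalityI subsetI)
    fix K assume K: "K \<in> {K. subgroup K G \<and> K \<subset> H}"
    then have "card K dvd p ^ m" using card_subgroup_dvd H by (metis mem_Collect_eq psubset_imp_subset)
    then obtain i where i: "card K = p ^ i" using prime by (metis divides_primepow_nat)
    have "card K < card H" using K finH by (simp add: psubset_card_mono)
    then have "i < m" using i H p_ge_2 by simp
    with i K show "K \<in> (\<Union>i\<in>{..<m}. ?S i)" by auto
  qed (use proper in blast)
  moreover have "?S i \<inter> ?S j = {}" if "i \<noteq> j" for i j
    using that p_ge_2 by auto
  ultimately have "(\<Sum>K\<in>{K. subgroup K G \<and> K \<subset> H}. F K) = (\<Sum>i<m. \<Sum>K\<in>?S i. F K)"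
    using fin by (simp add: sum.UNION_disjoint)
  also have "\<dots> = (\<Sum>i<m. of_nat (card (?S i)) * g i)"
  proof (rule sum.cong)
    fix i assume "i \<in> {..<m}"
    then have "(\<Sum>K\<in>?S i. F K) = (\<Sum>K\<in>?S i. g i)"
      using proper by (intro sum.cong) (auto intro: g)
    then show "(\<Sum>K\<in>?S i. F K) = of_nat (card (?S i)) * g i" by simp
  qed simp
  also have "\<dots> = (\<Sum>i<m. of_nat (pow_fact p m) / (of_nat (pow_fact p i) * of_nat (pow_fact p (m - i))) * g i)"
  proof (rule sum.cong)
    fix i assume "i \<in> {..<m}"
    then have "card (?S i) * pow_fact p i * pow_fact p (m - i) = pow_fact p m"
      by (intro card_subgroups[OF H]) simp
    then have "(of_nat (card (?S i)) * of_nat (pow_fact p i) * of_nat (pow_fact p (m - i)) :: 'c) =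
        of_nat (pow_fact p m)"
      by (simp only: flip: of_nat_mult)
    then show "of_nat (card (?S i)) * g i =
        of_nat (pow_fact p m) / (of_nat (pow_fact p i) * of_nat (pow_fact p (m - i))) * g i"
      using pow_fact_pos[OF p_ge_2, of i] pow_fact_pos[OF p_ge_2, of "m - i"]
      by (auto simp: field_simps)
  qed simp
  finally show ?thesis .
qed

end

section \<open>Sums over increasing tuples and their recursion\<close>

text \<open>The empty tuple is treated separately, as \<open>i k\<close> and \<open>i 1\<close> in the general summand are
  out of range for \<open>k = 0\<close>.\<close>

definition tuple_sum :: "nat \<Rightarrow> nat \<Rightarrow> nat \<Rightarrow> rat" where
  "tuple_sum p n k = (if k = 0 then 1 / of_nat (pow_fact p n) else
    (\<Sum>i\<in>increasing_tuples k (n - 1).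
         1 / of_nat (pow_fact p (n - i k) * (\<Prod>j = 2..k. pow_fact p (i j - i (j - 1))) *
                     pow_fact p (i 1))))"

lemma increasing_tuples_0: "increasing_tuples 0 m = {\<lambda>_. undefined}"
  by (auto simp: increasing_tuples_def strict_mono_on_def)

lemma finite_increasing_tuples: "finite (increasing_tuples k m)"
  by (rule finite_subset[of _ "{1..k} \<rightarrow>\<^sub>E {1..m}"])
    (auto simp: increasing_tuples_def intro: finite_PiE)

text \<open>The last entry \<open>l\<close> can be any value, and the other entries form an
  increasing tuple below \<open>l\<close>.\<close>

lemma increasing_tuples_Suc:
  "bij_betw (\<lambda>(l, t). t(Suc k := l)) (SIGMA l:{1..m}. increasing_tuples k (l - 1))
    (increasing_tuples (Suc k) m)"
\<comment> \<open>The inverse resets position \<open>Suc k\<close> to \<open>undefined\<close>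
  because shorter tuples must be extensional on \<open>{1..k}\<close>.\<close>
proof (rule bij_betw_byWitness[where f' = "\<lambda>t. (t (Suc k), t(Suc k := undefined))"])
  show "\<forall>a\<in>SIGMA l:{1..m}. increasing_tuples k (l - 1).
      (\<lambda>t. (t (Suc k), t(Suc k := undefined))) ((\<lambda>(l, t). t(Suc k := l)) a) = a"
    by (auto simp: increasing_tuples_def PiE_def extensional_def fun_eq_iff)
  show "\<forall>t\<in>increasing_tuples (Suc k) m.
      (\<lambda>(l, t). t(Suc k := l)) (t (Suc k), t(Suc k := undefined)) = t"
    by simp
  show "(\<lambda>(l, t). t(Suc k := l)) ` (SIGMA l:{1..m}. increasing_tuples k (l - 1))
      \<subseteq> increasing_tuples (Suc k) m"
  proof clarify
    fix l t assume l: "l \<in> {1..m}" and "t \<in> increasing_tuples k (l - 1)"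
    then have t: "t \<in> {1..k} \<rightarrow>\<^sub>E {1..l - 1}" "strict_mono_on {1..k} t"
      by (auto simp: increasing_tuples_def)
    have tj: "1 \<le> t j \<and> t j < l" if "j \<in> {1..k}" for j
      using PiE_mem[OF t(1) that] l by auto
    have "t(Suc k := l) \<in> {1..Suc k} \<rightarrow>\<^sub>E {1..m}"
    proof (rule PiE_I)
      fix j assume "j \<in> {1..Suc k}"
      then show "(t(Suc k := l)) j \<in> {1..m}" using tj[of j] l by (cases "j = Suc k") auto
    next
      fix j assume "j \<notin> {1..Suc k}"
      then show "(t(Suc k := l)) j = undefined" using PiE_arb[OF t(1), of j] by auto
    qed
    moreover have "strict_mono_on {1..Suc k} (t(Suc k := l))"
    proof (rule strict_mono_onI)
      fix r s assume rs: "r \<in> {1..Suc k}" "s \<in> {1..Suc k}" "r < s"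
      show "(t(Suc k := l)) r < (t(Suc k := l)) s"
      proof (cases "s = Suc k")
        case True
        then show ?thesis using rs tj[of r] by auto
      next
        case False
        then show ?thesis using rs strict_mono_onD[OF t(2), of r s] by auto
      qed
    qed
    ultimately show "t(Suc k := l) \<in> increasing_tuples (Suc k) m"
      by (simp add: increasing_tuples_def)
  qed
  show "(\<lambda>t. (t (Suc k), t(Suc k := undefined))) ` increasing_tuples (Suc k) m
      \<subseteq> (SIGMA l:{1..m}. increasing_tuples k (l - 1))"
  proof (rule image_subsetI)
    fix t assume "t \<in> increasing_tuples (Suc k) m"
    then have t: "t \<in> {1..Suc k} \<rightarrow>\<^sub>E {1..m}" "strict_mono_on {1..Suc k} t"
      by (auto simp: increasing_tuples_def)
    have lt: "1 \<le> t j \<and> t j < t (Suc k)" if "j \<in> {1..k}" for j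
      using PiE_mem[OF t(1), of j] strict_mono_onD[OF t(2), of j "Suc k"] that by auto
    have "t(Suc k := undefined) \<in> {1..k} \<rightarrow>\<^sub>E {1..t (Suc k) - 1}"
    proof (rule PiE_I)
      fix j assume "j \<in> {1..k}"
      then show "(t(Suc k := undefined)) j \<in> {1..t (Suc k) - 1}" using lt[of j] by auto
    next
      fix j assume "j \<notin> {1..k}"
      then show "(t(Suc k := undefined)) j = undefined" using PiE_arb[OF t(1), of j] by auto
    qed
    moreover have "strict_mono_on {1..k} (t(Suc k := undefined))"
      using t(2) by (auto simp: strict_mono_on_def)
    moreover have "t (Suc k) \<in> {1..m}" using PiE_mem[OF t(1), of "Suc k"] by simp
    ultimately show "(t (Suc k), t(Suc k := undefined)) \<in> (SIGMA l:{1..m}. increasing_tuples k (l - 1))"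
      by (simp add: increasing_tuples_def)
  qed
qed

text \<open>A last entry \<open>l\<close> contributes the factor \<open>pow_fact p (n - l)\<close>;
  what remains is the weight of the shortened tuple with \<open>l\<close> in the role of
  \<open>n\<close>.\<close>

lemma tuple_sum_Suc:
  "tuple_sum p n (Suc k) = (\<Sum>l = 1..n - 1. tuple_sum p l k / of_nat (pow_fact p (n - l)))"
proof -
  define w where "w n k i = (1 :: rat) / of_nat (pow_fact p (n - i k) *
    (\<Prod>j = 2..k. pow_fact p (i j - i (j - 1))) * pow_fact p (i 1))" for n k and i :: "nat \<Rightarrow> nat"
  have "tuple_sum p n (Suc k) = (\<Sum>i\<in>increasing_tuples (Suc k) (n - 1). w n (Suc k) i)"
    by (simp add: tuple_sum_def w_def)
  also have "\<dots> = (\<Sum>(l, t)\<in>(SIGMA l:{1..n - 1}. increasing_tuples k (l - 1)).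
      w n (Suc k) (t(Suc k := l)))"
    by (subst sum.reindex_bij_betw[OF increasing_tuples_Suc, symmetric]) (simp add: split_beta)
  also have "\<dots> = (\<Sum>l = 1..n - 1. \<Sum>t\<in>increasing_tuples k (l - 1). w n (Suc k) (t(Suc k := l)))"
    by (subst sum.Sigma) (auto simp: finite_increasing_tuples)
  also have "\<dots> = (\<Sum>l = 1..n - 1. tuple_sum p l k / of_nat (pow_fact p (n - l)))"
  proof (rule sum.cong)
    fix l
    show "(\<Sum>t\<in>increasing_tuples k (l - 1). w n (Suc k) (t(Suc k := l))) =
        tuple_sum p l k / of_nat (pow_fact p (n - l))"
    proof (cases k)
      \<comment> \<open>Here the only factor besides \<open>pow_fact p (n - l)\<close> is that of
        the first entry, which is \<open>l\<close> itself; this matches the special value of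
        \<open>tuple_sum p l 0\<close>.\<close>
      case 0
      then show ?thesis by (simp add: increasing_tuples_0 tuple_sum_def w_def)
    next
      case (Suc k')
      \<comment> \<open>The product factor at \<open>j = Suc k\<close> is
        \<open>pow_fact p (l - t k)\<close>, which becomes the leading factor of
        \<open>w l k t\<close>; the factors up to \<open>k\<close> do not see the update.\<close>
      have "w n (Suc k) (t(Suc k := l)) = w l k t / of_nat (pow_fact p (n - l))" for t
      proof -
        have "(\<Prod>j = 2..k. pow_fact p ((t(Suc k := l)) j - (t(Suc k := l)) (j - 1))) =
            (\<Prod>j = 2..k. pow_fact p (t j - t (j - 1)))"
          by (intro prod.cong) auto
        then show ?thesis
          using Suc by (simp add: w_def mult_ac)
      qed
      then have "(\<Sum>t\<in>increasing_tuples k (l - 1). w n (Suc k) (t(Suc k := l))) =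
          (\<Sum>t\<in>increasing_tuples k (l - 1). w l k t) / of_nat (pow_fact p (n - l))"
        by (simp add: sum_divide_distrib)
      then show ?thesis using Suc by (simp add: tuple_sum_def w_def)
    qed
  qed simp
  finally show ?thesis .
qed

text \<open>Strictly increasing tuples of length \<open>k\<close> need \<open>k\<close> values, but
  only \<open>n - 1\<close> are available. The bound \<open>1 \<le> n\<close> excludes
  \<open>tuple_sum p 0 0\<close>, which is 1.\<close>

lemma tuple_sum_eq_0: "1 \<le> n \<Longrightarrow> n \<le> k \<Longrightarrow> tuple_sum p n k = 0"
proof (induction k arbitrary: n)
  case (Suc k)
  then show ?case by (auto simp: tuple_sum_Suc intro!: sum.neutral)
qed simp

text \<open>This is \<open>S(n)\<close> of the overview; for \<open>p \<ge> 2\<close> and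
  \<open>n \<ge> 1\<close> its summand at \<open>k = 0\<close> accounts for the leading 1.\<close>

definition chain_sum :: "nat \<Rightarrow> nat \<Rightarrow> rat" where
  "chain_sum p n = of_nat (pow_fact p n) * (\<Sum>k<n. tuple_sum p n k)"

lemma chain_sum_rec:
  assumes "p \<ge> 2" "n \<ge> 1"
  shows "chain_sum p n = 1 + (\<Sum>i = 1..n - 1.
    of_nat (pow_fact p n) / (of_nat (pow_fact p i) * of_nat (pow_fact p (n - i))) * chain_sum p i)"
proof -
  have nz: "pow_fact p r \<noteq> 0" for r
    using pow_fact_pos[OF assms(1), of r] by simp
  obtain m where n: "n = Suc m" using assms(2) by (cases n) auto
  have "(\<Sum>k<n. tuple_sum p n k) = tuple_sum p n 0 + (\<Sum>k<m. tuple_sum p n (Suc k))"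
    unfolding n by (rule sum.lessThan_Suc_shift)
  also have "(\<Sum>k<m. tuple_sum p n (Suc k)) =
      (\<Sum>i = 1..m. (\<Sum>k<m. tuple_sum p i k) / of_nat (pow_fact p (n - i)))"
    by (simp add: tuple_sum_Suc n sum_divide_distrib) (rule sum.swap)
  \<comment> \<open>For \<open>k \<ge> i\<close> the tuple sums vanish, so the inner range shrinks
    to the one in \<open>chain_sum p i\<close>.\<close>
  also have "\<dots> = (\<Sum>i = 1..m. (\<Sum>k<i. tuple_sum p i k) / of_nat (pow_fact p (n - i)))"
  proof (rule sum.cong)
    fix i assume "i \<in> {1..m}"
    then have "(\<Sum>k<m. tuple_sum p i k) = (\<Sum>k<i. tuple_sum p i k)"
      by (intro sum.mono_neutral_right) (auto simp: tuple_sum_eq_0)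
    then show "(\<Sum>k<m. tuple_sum p i k) / of_nat (pow_fact p (n - i)) =
        (\<Sum>k<i. tuple_sum p i k) / of_nat (pow_fact p (n - i))" by simp
  qed simp
  also have "\<dots> = (\<Sum>i = 1..m. chain_sum p i / (of_nat (pow_fact p i) * of_nat (pow_fact p (n - i))))"
    by (simp add: chain_sum_def nz)
  finally have "chain_sum p n = of_nat (pow_fact p n) * (tuple_sum p n 0 +
      (\<Sum>i = 1..m. chain_sum p i / (of_nat (pow_fact p i) * of_nat (pow_fact p (n - i)))))"
    by (simp add: chain_sum_def)
  then show ?thesis
    using nz[of n] by (simp add: n tuple_sum_def distrib_left sum_distrib_left)
qed

section \<open>Counting rooted chains of subgroups\<close>

context elementary_abelian_group
begin

lemma card_rooted_subchains_subgroups: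
  assumes "subgroup H G" "card H = p ^ m"
  shows "(of_nat (card (rooted_subchains {K. subgroup K G} H)) :: rat) =
    (if m = 0 then 1 else 2 * chain_sum p m)"
  using assms
proof (induction m arbitrary: H rule: less_induct)
  case (less m)
  let ?R = "\<lambda>H. (of_nat (card (rooted_subchains {K. subgroup K G} H)) :: rat)"
  let ?g = "\<lambda>i. if i = 0 then 1 else 2 * chain_sum p i"
  let ?b = "\<lambda>i. of_nat (pow_fact p m) / (of_nat (pow_fact p i) * of_nat (pow_fact p (m - i))) :: rat"
  have "finite {K. subgroup K G}"
    using finite_carrier by (auto intro: finite_subset[of _ "Pow (carrier G)"] dest: subgroup.subset)
  then have "?R H = 1 + (\<Sum>K\<in>{K. subgroup K G \<and> K \<subset> H}. ?R K)"
    using less.prems by (simp add: card_rooted_subchains_rec)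
  also have "(\<Sum>K\<in>{K. subgroup K G \<and> K \<subset> H}. ?R K) = (\<Sum>i<m. ?b i * ?g i)"
    using less.prems by (rule sum_proper_subgroups) (rule less.IH)
  also have "1 + \<dots> = ?g m"
  proof (cases m)
    case (Suc m')
    have "(\<Sum>i<m. ?b i * ?g i) = ?b 0 * ?g 0 + (\<Sum>i = 1..m'. ?b i * ?g i)"
    proof -
      have "{..<m} = insert 0 {1..m'}" using Suc by auto
      then show ?thesis by simp
    qed
    also have "(\<Sum>i = 1..m'. ?b i * ?g i) = 2 * (\<Sum>i = 1..m'. ?b i * chain_sum p i)"
      unfolding sum_distrib_left by (intro sum.cong) auto
    \<comment> \<open>The trivial subgroup contributes this 1. With the 1 in front of the sum it
      gives twice the constant term of \<open>chain_sum_rec\<close>, whose sum starts at index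
      1.\<close>
    also have "?b 0 * ?g 0 = 1"
      using pow_fact_pos[OF p_ge_2, of m] by simp
    finally show ?thesis
      using chain_sum_rec[OF p_ge_2, of m] Suc by simp
  qed simp
  finally show ?case .
qed

end

section \<open>The direct power of the cyclic group of order \<open>p\<close>\<close>

lemma elementary_abelian_group_elem_abelian_group:
  assumes "prime p"
  shows "elementary_abelian_group (elem_abelian_group p n) p"
proof -
  have "p > 0" using assms by (simp add: prime_gt_0_nat)
  interpret comm_group "elem_abelian_group p n"
    unfolding elem_abelian_group_def
    by (rule group.group_comm_groupI) (auto simp: fun_eq_iff add.commute)
  have car: "carrier (elem_abelian_group p n) = {1..n} \<rightarrow>\<^sub>E {0..<int p}"
    using \<open>p > 0\<close> by (simp add: elem_abelian_group_def carrier_integer_mod_group)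
  \<comment> \<open>Powers are coordinatewise multiples modulo \<open>p\<close>, so the exponent
    \<open>p\<close> gives zero in every coordinate.\<close>
  have pow: "x [^]\<^bsub>elem_abelian_group p n\<^esub> k = (\<lambda>i\<in>{1..n}. (int k * x i) mod int p)"
    for x and k :: nat
  proof (induction k)
    case 0
    show ?case by (simp add: elem_abelian_group_def)
  next
    case (Suc k)
    then show ?case
      by (simp add: elem_abelian_group_def mod_add_right_eq distrib_right add.commute cong: restrict_cong)
  qed
  show ?thesis
  proof
    show "finite (carrier (elem_abelian_group p n))" by (simp add: car finite_PiE)
  next
    fix x assume "x \<in> carrier (elem_abelian_group p n)"
    then show "x [^]\<^bsub>elem_abelian_group p n\<^esub> p = \<one>\<^bsub>elem_abelian_group p n\<^esub>"
      by (simp add: pow) (simp add: elem_abelian_group_def)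
  qed (rule assms)
qed

lemma card_elem_abelian_group:
  assumes "p > 0"
  shows "card (carrier (elem_abelian_group p n)) = p ^ n"
  using assms by (simp add: elem_abelian_group_def carrier_integer_mod_group card_PiE)

theorem theorem3:
  fixes p n :: nat
  assumes "prime p" and "n \<ge> 1"
  shows "(of_nat (num_rooted_chains (elem_abelian_group p n)) :: rat) =
    2 + 2 * of_nat (pow_fact p n) *
      (\<Sum>k = 1..n - 1. \<Sum>i\<in>increasing_tuples k (n - 1).
         1 / of_nat (pow_fact p (n - i k) * (\<Prod>j = 2..k. pow_fact p (i j - i (j - 1))) *
                     pow_fact p (i 1)))"
proof -
  let ?G = "elem_abelian_group p n"
  interpret elementary_abelian_group ?G p
    using assms(1) by (rule elementary_abelian_group_elem_abelian_group)
  \<comment> \<open>Every subgroup lies in the carrier, so the maximality demanded of the root holds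
    automatically.\<close>
  have "rooted_chains ?G = rooted_subchains {H. subgroup H ?G} (carrier ?G)"
    by (auto simp: rooted_chains_def rooted_subchains_def subset_chain_def dest: subgroup.subset)
  then have "of_nat (num_rooted_chains ?G) = 2 * chain_sum p n"
    using card_rooted_subchains_subgroups[OF subgroup_self card_elem_abelian_group[OF p_pos]] assms(2)
    by (simp add: num_rooted_chains_def)
  also have "chain_sum p n = of_nat (pow_fact p n) *
      (tuple_sum p n 0 + (\<Sum>k = 1..n - 1. tuple_sum p n k))"
  proof -
    have "{..<n} = insert 0 {1..n - 1}" using assms(2) by auto
    then show ?thesis by (simp add: chain_sum_def)
  qed
  \<comment> \<open>The empty tuple contributes \<open>pow_fact p n\<close> times its reciprocal,
    which doubled is the constant 2.\<close>
  also have "2 * \<dots> = 2 + 2 * of_nat (pow_fact p n) * (\<Sum>k = 1..n - 1. tuple_sum p n k)"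
    using pow_fact_pos[OF p_ge_2, of n] by (simp add: tuple_sum_def distrib_left)
  finally show ?thesis by (simp add: tuple_sum_def)
qed

end
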